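(* Let $r \ge 2$ and let $\boldsymbol{G}$ be the standard generator matrix of the $r$-th order binary Reed--Muller code $\mathrm{RM}(r,r+1)$, which has dimension $k = 2^{r+1}-1$. Then its service rate region is $$\mathcal{S}(\boldsymbol{G}) = \left\{\boldsymbol{\lambda}\in\mathbb{R}_{\ge 0}^{k} : \sum_{i=1}^{k}\lambda_i \le 2\right\} = \operatorname{conv}\bigl(\{\boldsymbol{0}_k, \boldsymbol{v}_1,\dots,\boldsymbol{v}_k\}\bigr),$$ where $\boldsymbol{v}_i = 2\,\boldsymbol{e}_i$ for $i\in[k]$.
   Context: Notation: $[a]=\{1,\dots,a\}$; $\boldsymbol{0}_k$ is the zero vector of length $k$; $\boldsymbol{e}_i$ is the $i$-th unit vector of length $k$; $\operatorname{conv}$ denotes convex hull. Reed--Muller code and generator matrix. For $0\le r\le m$, the binary code $\mathrm{RM}(r,m)$ consists of the evaluation vectors, over all $2^m$ points of $\mathbb{F}_2^m$, of the polynomials of degree at most $r$ in $m$ binary variables $v_1,\dots,v_m$. It has length $n=2^m$ and dimension $k=\sum_{i=0}^r\binom{m}{i}$. Its standard generator matrix $\boldsymbol{G}\in\mathbb{F}_2^{k\times n}$ has one row for each monomial $\prod_{t\in T}v_t$ with $T\subseteq[m]$, $|T|\le r$ (ordered by increasing degree and, within each degree, in reverse lexicographic order of the variable indices), and one column for each point of $\mathbb{F}_2^m$ (in lexicographic order, the first column being the all-zero point and the $2^m$-th column being the all-one point); each entry is the value of the monomial at the point. Recovery sets. The $k$ message symbols $s_1,\dots,s_k$ correspond to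 the $k$ rows of $\boldsymbol{G}$, and the $n$ servers correspond to its columns $\boldsymbol{g}_1,\dots,\boldsymbol{g}_n$. A set $R\subseteq[n]$ is a recovery set for $s_i$ if $\boldsymbol{e}_i$ is an $\mathbb{F}_2$-linear combination of the columns $\{\boldsymbol{g}_j: j\in R\}$ and no proper subset of $R$ has this property (i.e., recovery sets are taken to be minimal). Let $R_{i,1},\dots,R_{i,t_i}$ be all the recovery sets for $s_i$. Service rate region. All servers have capacity $1$. $\mathcal{S}(\boldsymbol{G})\subseteq\mathbb{R}_{\ge0}^k$ is the set of all $\boldsymbol{\lambda}=(\lambda_1,\dots,\lambda_k)\in\mathbb{R}_{\ge 0}^k$ for which there exist $\lambda_{i,j}\in\mathbb{R}_{\ge0}$ ($i\in[k]$, $j\in[t_i]$) with $\sum_{j=1}^{t_i}\lambda_{i,j}=\lambda_i$ for all $i\in[k]$, and $\sum_{i=1}^k\sum_{j\in[t_i]:\,\ell\in R_{i,j}}\lambda_{i,j}\le 1$ for all $\ell\in[n]$. *)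

theory Defs
  imports
    "HOL-Analysis.Analysis"
    "HOL-Library.Z2"
    "HOL-Analysis.Finite_Function_Topology"
    "Jordan_Normal_Form.VS_Connect"
begin

text \<open>
  The field with two elements is \<^typ>\<open>bit\<close>. Matrices over it are those of
  \<^theory>\<open>Jordan_Normal_Form.Matrix\<close>, so rows, columns and coordinates are numbered from 0:
  the message symbols are \<open>{..<k}\<close> and the servers are \<open>{..<n}\<close>. Only the variables
  \<open>v\<^sub>1, \<dots>, v\<^sub>m\<close> are numbered from 1.

  Because \<open>k\<close> depends on \<open>r\<close>, the space of real vectors of length \<open>k\<close> is taken to be the set of
  finitely supported functions \<^typ>\<open>nat \<Rightarrow>\<^sub>0 real\<close> with support in \<open>{..<k}\<close>. The type is an
  instance of \<^class>\<open>real_vector\<close>, so the convex hull of the library applies to it.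
\<close>

definition nonneg_orthant :: "nat \<Rightarrow> (nat \<Rightarrow>\<^sub>0 real) set" where
  "nonneg_orthant k =
     {x. Poly_Mapping.keys x \<subseteq> {..<k} \<and> (\<forall>i<k. 0 \<le> Poly_Mapping.lookup x i)}"

definition real_unit :: "nat \<Rightarrow> (nat \<Rightarrow>\<^sub>0 real)" where
  "real_unit i = Poly_Mapping.single i 1"


section \<open>Reed--Muller codes\<close>

text \<open>
  The points of the binary \<open>m\<close>-space in lexicographic order: \<open>v\<^sub>t\<close> takes at point number \<open>j\<close> the
  \<open>t\<close>-th digit, from the left, of the \<open>m\<close>-digit binary expansion of \<open>j\<close>.
\<close>

definition rm_point :: "nat \<Rightarrow> nat \<Rightarrow> nat \<Rightarrow> bit" where
  "rm_point m j t = of_bool (odd (j div 2 ^ (m - t)))"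

lemma rm_point_example:
  "map (\<lambda>j. map (rm_point 2 j) [1, 2]) [0, 1, 2, 3] = [[0, 0], [0, 1], [1, 0], [1, 1]]"
  by (simp add: rm_point_def)

text \<open>
  A polynomial is a finitely supported map from exponent vectors to coefficients.
\<close>

definition mpoly_eval :: "((nat \<Rightarrow>\<^sub>0 nat) \<Rightarrow>\<^sub>0 'a::comm_semiring_1) \<Rightarrow> (nat \<Rightarrow> 'a) \<Rightarrow> 'a" where
  "mpoly_eval p x =
     (\<Sum>a\<in>Poly_Mapping.keys p. Poly_Mapping.lookup p a *
        (\<Prod>t\<in>Poly_Mapping.keys a. x t ^ Poly_Mapping.lookup a t))"

definition mpolys_upto :: "nat \<Rightarrow> nat \<Rightarrow> ((nat \<Rightarrow>\<^sub>0 nat) \<Rightarrow>\<^sub>0 'a::zero) set" where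
  "mpolys_upto r m =
     {p. \<forall>a\<in>Poly_Mapping.keys p. Poly_Mapping.keys a \<subseteq> {1..m} \<and>
           (\<Sum>t\<in>Poly_Mapping.keys a. Poly_Mapping.lookup a t) \<le> r}"

definition reed_muller_code :: "nat \<Rightarrow> nat \<Rightarrow> bit Matrix.vec set" where
  "reed_muller_code r m =
     (\<lambda>p. Matrix.vec (2 ^ m) (\<lambda>j. mpoly_eval p (rm_point m j))) ` mpolys_upto r m"

definition code_dim :: "nat \<Rightarrow> 'a::field Matrix.vec set \<Rightarrow> nat" where
  "code_dim n C = vectorspace.dim class_ring ((module_vec TYPE('a) n)\<lparr>carrier := C\<rparr>)"

text \<open>
  A monomial \<open>\<Prod>t\<in>T. v\<^sub>t\<close> is represented by the increasing list of the elements of \<open>T\<close>.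
  The members of \<^term>\<open>subseqs [1..<m + 1]\<close> of a fixed length are listed there in lexicographic
  order (lemma \<open>sorted_subseqs_of_length\<close>), so the reversed list is in reverse lexicographic order.
\<close>

definition rm_monomials :: "nat \<Rightarrow> nat \<Rightarrow> nat list list" where
  "rm_monomials r m =
     concat (map (\<lambda>d. rev (filter (\<lambda>T. length T = d) (subseqs [1..<m + 1]))) [0..<r + 1])"

lemma filter_Nil_subseqs: "filter (\<lambda>T. T = []) (subseqs xs) = [[]]"
  by (induction xs) (simp_all add: Let_def filter_map o_def)

lemma sorted_subseqs_of_length:
  assumes "sorted_wrt (<) xs"
  shows "sorted_wrt (\<lambda>S T. (S, T) \<in> lexord {(a, b). a < b})
           (filter (\<lambda>T. length T = d) (subseqs (xs :: nat list)))"
  using assms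
proof (induction xs arbitrary: d)
  case Nil
  then show ?case by simp
next
  case (Cons x xs)
  show ?case
  proof (cases d)
    case 0
    then show ?thesis by (simp add: filter_Nil_subseqs del: subseqs.simps)
  next
    case (Suc e)
    have shorter: "filter (\<lambda>T. length T = d) (map ((#) x) ys) =
        map ((#) x) (filter (\<lambda>T. length T = e) ys)" for ys
      using Suc by (simp add: filter_map o_def)
    have "(x # S, T) \<in> lexord {(a, b). a < b}"
      if "T \<in> set (subseqs xs)" "length T = d" for S T
    proof (cases T)
      case Nil
      then show ?thesis using that Suc by simp
    next
      case (Cons y ys)
      have "set T \<subseteq> set xs"
        using that subseqs_powset[of xs] by (metis Pow_iff image_eqI)
      then show ?thesis using Cons \<open>sorted_wrt (<) (x # xs)\<close> by auto
    qed
    then show ?thesis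
      using Cons.IH[of d] Cons.IH[of e] Cons.prems
      by (auto simp: Let_def shorter sorted_wrt_append sorted_wrt_map)
  qed
qed

lemma length_rm_monomials: "length (rm_monomials r m) = (\<Sum>d\<le>r. m choose d)"
proof -
  have "length (filter (\<lambda>T. length T = d) (subseqs xs)) = length xs choose d" for d and xs :: "nat list"
  proof (induction xs arbitrary: d)
    case Nil
    then show ?case by (cases d) simp_all
  next
    case (Cons x xs)
    then show ?case by (cases d) (simp_all add: Let_def filter_map o_def filter_Nil_subseqs)
  qed
  then have "length (rm_monomials r m) = (\<Sum>d\<leftarrow>[0..<r + 1]. m choose d)"
    by (simp add: rm_monomials_def length_concat o_def del: upt_Suc)
  also have "\<dots> = (\<Sum>d\<le>r. m choose d)"
    by (metis Suc_eq_plus1 atLeast0LessThan lessThan_Suc_atMost interv_sum_list_conv_sum_set_nat set_upt)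
  finally show ?thesis .
qed

lemma rm_monomials_example:
  "rm_monomials 2 3 = [[], [3], [2], [1], [2, 3], [1, 3], [1, 2]]"
  by code_simp

definition rm_generator_matrix :: "nat \<Rightarrow> nat \<Rightarrow> bit mat" where
  "rm_generator_matrix r m =
     mat (\<Sum>d\<le>r. m choose d) (2 ^ m) (\<lambda>(i, j). \<Prod>t\<in>set (rm_monomials r m ! i). rm_point m j t)"


section \<open>Service rate region\<close>

definition recovers :: "'a::field mat \<Rightarrow> nat \<Rightarrow> nat set \<Rightarrow> bool" where
  "recovers G i R \<longleftrightarrow> R \<subseteq> {..<dim_col G} \<and>
     unit_vec (dim_row G) i \<in>
       LinearCombinations.module.span class_ring (module_vec TYPE('a) (dim_row G)) (col G ` R)"

definition recovery_sets :: "'a::field mat \<Rightarrow> nat \<Rightarrow> nat set set" where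
  "recovery_sets G i = {R. recovers G i R \<and> (\<forall>R'. R' \<subset> R \<longrightarrow> \<not> recovers G i R')}"

lemma finite_recovery_sets: "finite (recovery_sets G i)"
  by (rule finite_subset[of _ "Pow {..<dim_col G}"]) (auto simp: recovery_sets_def recovers_def)

text \<open>
  The rates \<open>\<lambda>\<^sub>i\<^sub>,\<^sub>j\<close> are indexed by the recovery sets themselves: \<open>\<mu> i R\<close> is the part of the
  demand for symbol \<open>i\<close> that is served by \<open>R\<close>.
\<close>

definition service_rate_region :: "'a::field mat \<Rightarrow> (nat \<Rightarrow>\<^sub>0 real) set" where
  "service_rate_region G =
     {rates \<in> nonneg_orthant (dim_row G). \<exists>\<mu> :: nat \<Rightarrow> nat set \<Rightarrow> real.
        (\<forall>i<dim_row G. \<forall>R\<in>recovery_sets G i. 0 \<le> \<mu> i R) \<and>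
        (\<forall>i<dim_row G. (\<Sum>R\<in>recovery_sets G i. \<mu> i R) = Poly_Mapping.lookup rates i) \<and>
        (\<forall>l<dim_col G. (\<Sum>i<dim_row G. \<Sum>R | R \<in> recovery_sets G i \<and> l \<in> R. \<mu> i R) \<le> 1)}"

end

theory Submission
  imports Defs "Jordan_Normal_Form.DL_Rank"
begin

text \<open>
  Identify points and monomials with subsets of \<open>U = {1..r + 1}\<close>. The matrix then has a column for
  every subset \<open>X\<close> of \<open>U\<close>, a row for every proper subset \<open>A\<close>, and entry 1 iff \<open>A \<subseteq> X\<close>. By Moebius
  inversion over the field with two elements, the columns \<open>X \<subseteq> A\<close> sum to the unit vector of \<open>A\<close>, and
  the only linear dependency of the columns is that all of them sum to 0. So the symbol of \<open>A\<close> has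
  exactly two recovery sets: \<open>{X. X \<subseteq> A}\<close> and its complement. The former always contains the server
  \<open>{}\<close> and the latter the server \<open>U\<close>, and the capacities of these two servers bound the total rate
  by 2. Conversely, if every demand is split evenly between its two recovery sets, each server
  carries half of the total rate.
\<close>

section \<open>Parity of intervals in the subset lattice\<close>

text \<open>For \<open>A \<subseteq> B\<close> the interval is a copy of the power set of
  \<open>B - A\<close>, whose size \<open>2 ^ card (B - A)\<close> is odd only for
  \<open>A = B\<close>. This is Moebius inversion modulo 2, where the signs disappear.\<close>

lemma sum_interval_bit:
  assumes "finite B"
  shows "(\<Sum>X | A \<subseteq> X \<and> X \<subseteq> B. 1) = (of_bool (A = B) :: bit)"
proof (cases "A \<subseteq> B")
  case True
  have "bij_betw (\<lambda>Y. A \<union> Y) (Pow (B - A)) {X. A \<subseteq> X \<and> X \<subseteq> B}"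
    by (rule bij_betw_byWitness[where f' = "\<lambda>X. X - A"]) (use True in auto)
  then have "card {X. A \<subseteq> X \<and> X \<subseteq> B} = 2 ^ card (B - A)"
    using assms by (metis bij_betw_same_card card_Pow finite_Diff)
  moreover have "card (B - A) = 0 \<longleftrightarrow> A = B"
    using assms True by auto
  ultimately show ?thesis by simp
next
  case False
  then have "{X. A \<subseteq> X \<and> X \<subseteq> B} = {}" "A \<noteq> B" by auto
  then show ?thesis by (simp only: sum.empty of_bool_eq if_False)
qed

section \<open>Spans of indexed columns and the equations for recovery\<close>

text \<open>\<open>lincomb\<close> attaches coefficients to vectors, whereas here they belong to
  indices, and \<open>f\<close> may repeat values. One direction puts the coefficient on one index
  per vector and 0 on the others; the converse adds up the coefficients over each fibre of
  \<open>f\<close>.\<close>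

lemma (in vec_space) span_image_iff:
  assumes "finite R" "f ` R \<subseteq> carrier_vec n"
  shows "v \<in> span (f ` R) \<longleftrightarrow>
    v \<in> carrier_vec n \<and> (\<exists>c. \<forall>i<n. v $ i = (\<Sum>j\<in>R. c j * f j $ i))"
proof (intro iffI conjI; (elim conjE exE)?)
  assume v: "v \<in> span (f ` R)"
  then obtain a where a: "v = lincomb a (f ` R)"
    using finite_span[of "f ` R"] assms by auto
  obtain S where S: "S \<subseteq> R" "inj_on f S" "f ` R = f ` S"
    using subset_image_inj[of "f ` R" f R] by auto
  have vi: "v $ i = (\<Sum>j\<in>R. (if j \<in> S then a (f j) else 0) * f j $ i)" if "i < n" for i
  proof -
    have "v $ i = (\<Sum>j\<in>S. a (f j) * f j $ i)"
      using lincomb_index[OF that assms(2), of a] S by (simp add: a sum.reindex)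
    also have "\<dots> = (\<Sum>j\<in>R. (if j \<in> S then a (f j) else 0) * f j $ i)"
      using S(1) assms(1) by (intro sum.mono_neutral_cong_left) auto
    finally show ?thesis .
  qed
  show "\<exists>c. \<forall>i<n. v $ i = (\<Sum>j\<in>R. c j * f j $ i)"
    by (intro exI[of _ "\<lambda>j. if j \<in> S then a (f j) else 0"] allI impI) (rule vi)
  show "v \<in> carrier_vec n"
    using v assms(2) by (rule span_closed[rotated])
next
  fix c assume v: "v \<in> carrier_vec n" and c: "\<forall>i<n. v $ i = (\<Sum>j\<in>R. c j * f j $ i)"
  define a where "a x = (\<Sum>j | j \<in> R \<and> f j = x. c j)" for x
  have dim: "dim_vec (lincomb a (f ` R)) = n"
    by (rule lincomb_dim[OF finite_imageI[OF assms(1)] assms(2)])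
  have "v = lincomb a (f ` R)"
  proof (rule eq_vecI)
    show "dim_vec v = dim_vec (lincomb a (f ` R))"
      unfolding dim using v by (rule carrier_vecD)
    fix i assume "i < dim_vec (lincomb a (f ` R))"
    then have i: "i < n" by (simp only: dim)
    have "v $ i = (\<Sum>x\<in>f ` R. \<Sum>j | j \<in> R \<and> f j = x. c j * f j $ i)"
      using c i sum.image_gen[OF assms(1), of "\<lambda>j. c j * f j $ i" f] by (simp only:)
    also have "\<dots> = (\<Sum>x\<in>f ` R. a x * x $ i)"
      by (simp add: a_def sum_distrib_right)
    finally show "v $ i = lincomb a (f ` R) $ i"
      by (simp only: lincomb_index[OF i assms(2)])
  qed
  then show "v \<in> span (f ` R)"
    using finite_span[of "f ` R"] assms by auto
qed

lemma recovers_iff: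
  fixes G :: "'a::field mat"
  assumes "i < dim_row G"
  shows "recovers G i R \<longleftrightarrow> R \<subseteq> {..<dim_col G} \<and>
    (\<exists>c. \<forall>a<dim_row G. (\<Sum>j\<in>R. c j * G $$ (a, j)) = of_bool (a = i))"
proof (cases "R \<subseteq> {..<dim_col G}")
  case True
  interpret vec_space "TYPE('a)" "dim_row G" .
  have fin: "finite R" using True finite_subset by blast
  have "unit_vec (dim_row G) i \<in> span (col G ` R) \<longleftrightarrow>
    (\<exists>c. \<forall>a<dim_row G. unit_vec (dim_row G) i $ a = (\<Sum>j\<in>R. c j * col G j $ a))"
    using fin by (subst span_image_iff) auto
  also have "\<dots> \<longleftrightarrow> (\<exists>c. \<forall>a<dim_row G. (\<Sum>j\<in>R. c j * G $$ (a, j)) = of_bool (a = i))"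
  proof -
    have entry: "(unit_vec (dim_row G) i $ a = (\<Sum>j\<in>R. c j * col G j $ a)) \<longleftrightarrow>
        (\<Sum>j\<in>R. c j * G $$ (a, j)) = of_bool (a = i)" if a: "a < dim_row G" for a c
    proof -
      have "(\<Sum>j\<in>R. c j * col G j $ a) = (\<Sum>j\<in>R. c j * G $$ (a, j))"
        using a True by (intro sum.cong) auto
      moreover have "unit_vec (dim_row G) i $ a = of_bool (a = i)"
        using a assms by simp
      ultimately show ?thesis by metis
    qed
    show ?thesis
      by (intro iff_exI iff_allI imp_cong refl) (rule entry)
  qed
  finally show ?thesis using True by (simp add: recovers_def)
qed (simp add: recovers_def)

section \<open>Points and monomials as subsets of the variables\<close>

definition rm_support :: "nat \<Rightarrow> nat \<Rightarrow> nat set" where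
  "rm_support m j = {t \<in> {1..m}. rm_point m j t = 1}"

text \<open>Binary digits determine a number below \<open>2 ^ m\<close>; surjectivity then follows
  since both sides have \<open>2 ^ m\<close> elements.\<close>

lemma bij_rm_support: "bij_betw (rm_support m) {..<2 ^ m} (Pow {1..m})"
proof -
  have "inj_on (rm_support m) {..<2 ^ m}"
  proof (rule inj_onI)
    fix j l :: nat
    assume j: "j \<in> {..<2 ^ m}" and l: "l \<in> {..<2 ^ m}" and eq: "rm_support m j = rm_support m l"
    show "j = l"
    proof (rule bit_eqI)
      fix q
      show "bit j q = bit l q"
      proof (cases "q < m")
        case True
        \<comment> \<open>Variables are numbered from the left, so bit \<open>q\<close> of the
          number is the value of variable \<open>m - q\<close>.\<close>
        then have "m - q \<in> rm_support m j \<longleftrightarrow> m - q \<in> rm_support m l" using eq by simp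
        moreover have "m - q \<in> {1..m}" "m - (m - q) = q" using True by auto
        ultimately show ?thesis by (simp add: rm_support_def rm_point_def bit_iff_odd)
      next
        case False
        have "take_bit m j = j" "take_bit m l = l"
          using j l by (simp_all add: take_bit_nat_eq_self_iff)
        with False show ?thesis by (metis bit_take_bit_iff)
      qed
    qed
  qed
  moreover from this have "rm_support m ` {..<2 ^ m} = Pow {1..m}"
    by (intro card_subset_eq) (simp_all add: card_image card_Pow, auto simp: rm_support_def)
  ultimately show ?thesis by (simp add: bij_betw_def)
qed

lemma set_rm_monomials: "set ` set (rm_monomials r m) = {A. A \<subseteq> {1..m} \<and> card A \<le> r}"
proof -
  have dist: "length T = card (set T)" if "T \<in> set (subseqs [1..<m + 1])" for T
    using subseqs_distinctD[OF that] by (simp add: distinct_card)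
  have "set (rm_monomials r m) = {T \<in> set (subseqs [1..<m + 1]). length T \<le> r}"
    by (auto simp: rm_monomials_def simp del: upt_Suc)
  then have "set ` set (rm_monomials r m) =
      {A \<in> set ` set (subseqs [1..<m + 1]). card A \<le> r}"
    using dist by (auto simp del: upt_Suc)
  then show ?thesis
    by (auto simp: subseqs_powset simp del: upt_Suc)
qed

lemma sum_choose_Suc_upto: "(\<Sum>d\<le>r. Suc r choose d) = 2 ^ Suc r - 1"
  using choose_row_sum[of "Suc r"] by simp

text \<open>Among \<open>r + 1\<close> variables, degree at most \<open>r\<close> excludes only the
  product of all of them. The list has as many entries as there are proper subsets and reaches all
  of them, so no monomial occurs twice.\<close>

lemma bij_rm_monomials:
  "bij_betw (\<lambda>i. set (rm_monomials r (Suc r) ! i)) {..<2 ^ Suc r - 1} (Pow {1..Suc r} - {{1..Suc r}})"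
proof -
  let ?xs = "rm_monomials r (Suc r)"
  have len: "length ?xs = 2 ^ Suc r - 1"
    by (simp only: length_rm_monomials sum_choose_Suc_upto)
  have proper: "card A \<le> r \<longleftrightarrow> A \<noteq> {1..Suc r}" if "A \<subseteq> {1..Suc r}" for A
    using that card_mono[OF _ that] card_subset_eq[OF _ that] by fastforce
  have img: "set ` set ?xs = Pow {1..Suc r} - {{1..Suc r}}"
    unfolding set_rm_monomials using proper by auto
  have "card (set (map set ?xs)) = length (map set ?xs)"
    using len img by (simp add: card_Pow)
  then have "distinct (map set ?xs)" by (rule card_distinct)
  then have "inj_on (\<lambda>i. set (?xs ! i)) {..<2 ^ Suc r - 1}"
    using len by (auto simp: inj_on_def distinct_conv_nth)
  moreover have "(\<lambda>i. set (?xs ! i)) ` {..<2 ^ Suc r - 1} = set ` set ?xs"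
    using len by (auto simp: set_conv_nth)
  ultimately show ?thesis by (simp add: bij_betw_def img)
qed

lemma rm_monomial_at_point:
  assumes "A \<subseteq> {1..m}"
  shows "(\<Prod>t\<in>A. rm_point m j t) = of_bool (A \<subseteq> rm_support m j)"
proof -
  have "finite A" using assms finite_subset by blast
  show ?thesis
  proof (cases "A \<subseteq> rm_support m j")
    case True
    then show ?thesis by (auto simp: rm_support_def intro!: prod.neutral)
  next
    case False
    then obtain t where "t \<in> A" "rm_point m j t \<noteq> 1"
      using assms by (auto simp: rm_support_def simp del: bit_not_one_iff)
    with False \<open>finite A\<close> show ?thesis by auto
  qed
qed

section \<open>The scaled simplex as a convex hull\<close>

lemma lookup_scaleR [simp]: "Poly_Mapping.lookup (c *\<^sub>R x) i = c *\<^sub>R Poly_Mapping.lookup x i"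
proof -
  have "finite {i. c *\<^sub>R Poly_Mapping.lookup x i \<noteq> 0}"
    by (rule finite_subset[OF _ finite_lookup[of x]]) auto
  then show ?thesis by (simp add: scaleR_poly_mapping_def)
qed

lemma mem_nonneg_orthant_iff:
  "x \<in> nonneg_orthant k \<longleftrightarrow>
    (\<forall>i\<ge>k. Poly_Mapping.lookup x i = 0) \<and> (\<forall>i<k. 0 \<le> Poly_Mapping.lookup x i)"
  unfolding nonneg_orthant_def by (auto simp: in_keys_iff subset_iff) (metis not_le)

lemma scaled_simplex_eq_convex_hull:
  fixes s :: real
  assumes "s > 0"
  shows "{x \<in> nonneg_orthant k. (\<Sum>i<k. Poly_Mapping.lookup x i) \<le> s} =
    convex hull ({0} \<union> {s *\<^sub>R real_unit i | i. i < k})" (is "?S = convex hull ?V")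
proof (rule antisym)
  show "?S \<subseteq> convex hull ?V"
  proof
    fix x assume x: "x \<in> ?S"
    \<comment> \<open>The index \<open>k\<close> stands for the vertex 0 and takes up the slack that
      the weights \<open>Poly_Mapping.lookup x i / s\<close> of the other vertices leave below
      1.\<close>
    define y where "y i = (if i = k then 0 else s *\<^sub>R real_unit i)" for i
    define c where "c i = (if i = k then 1 - (\<Sum>i<k. Poly_Mapping.lookup x i) / s
      else Poly_Mapping.lookup x i / s)" for i
    have [simp]: "{..k} - {k} = {..<k}" by auto
    have "(\<Sum>i\<le>k. c i *\<^sub>R y i) \<in> convex hull ?V"
    proof (rule convex_sum)
      show "sum c {..k} = 1"
        by (simp add: sum.remove[of "{..k}" k] c_def sum_divide_distrib)
      show "0 \<le> c i" if "i \<in> {..k}" for i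
        using that x assms by (auto simp: c_def mem_nonneg_orthant_iff)
      show "y i \<in> convex hull ?V" if "i \<in> {..k}" for i
        using that by (intro hull_inc) (auto simp: y_def)
    qed simp_all
    moreover have "(\<Sum>i\<le>k. c i *\<^sub>R y i) = x"
    proof (rule poly_mapping_eqI)
      fix l
      have "Poly_Mapping.lookup (\<Sum>i\<le>k. c i *\<^sub>R y i) l = (\<Sum>i\<le>k. Poly_Mapping.lookup (c i *\<^sub>R y i) l)"
        by (rule lookup_sum)
      also have "\<dots> = (\<Sum>i<k. if i = l then Poly_Mapping.lookup x l else 0)"
        using assms
        by (intro sum.mono_neutral_cong_right)
          (auto simp: y_def c_def real_unit_def lookup_single when_def)
      also have "\<dots> = Poly_Mapping.lookup x l"
        using x by (simp add: mem_nonneg_orthant_iff)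
      finally show "Poly_Mapping.lookup (\<Sum>i\<le>k. c i *\<^sub>R y i) l = Poly_Mapping.lookup x l" .
    qed
    ultimately show "x \<in> convex hull ?V" by simp
  qed
  show "convex hull ?V \<subseteq> ?S"
  proof (rule hull_minimal)
    show "?V \<subseteq> ?S"
      using assms
      by (auto simp: mem_nonneg_orthant_iff real_unit_def lookup_single when_def sum_distrib_left[symmetric])
    show "convex ?S"
    proof (rule convexI)
      fix x y and u v :: real
      assume xy: "x \<in> ?S" "y \<in> ?S" and uv: "0 \<le> u" "0 \<le> v" "u + v = 1"
      have "(\<Sum>i<k. Poly_Mapping.lookup (u *\<^sub>R x + v *\<^sub>R y) i) =
          u * (\<Sum>i<k. Poly_Mapping.lookup x i) + v * (\<Sum>i<k. Poly_Mapping.lookup y i)"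
        by (simp add: lookup_add sum.distrib sum_distrib_left)
      also have "\<dots> \<le> s"
        using xy uv by (intro convex_bound_le) auto
      finally show "u *\<^sub>R x + v *\<^sub>R y \<in> ?S"
        using xy uv by (auto simp: mem_nonneg_orthant_iff lookup_add)
    qed
  qed
qed

section \<open>Inclusion matrices of proper subsets against all subsets\<close>

text \<open>\<open>P j\<close> is the subset attached to column \<open>j\<close>, \<open>M i\<close>
  the one attached to row \<open>i\<close>. Arbitrary bijective numberings separate the lattice
  argument from the order of points and monomials in the standard generator matrix.\<close>

locale proper_subset_incidence =
  fixes U :: "'u set" and n k :: nat and P M :: "nat \<Rightarrow> 'u set" and G :: "bit mat"
  assumes finite_U: "finite U"
    and bij_P: "bij_betw P {..<n} (Pow U)"
    and bij_M: "bij_betw M {..<k} (Pow U - {U})"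
    and G_carrier: "G \<in> carrier_mat k n"
    and G_entry: "\<And>i j. i < k \<Longrightarrow> j < n \<Longrightarrow> G $$ (i, j) = of_bool (M i \<subseteq> P j)"
begin

lemma dim_G [simp]: "dim_row G = k" "dim_col G = n"
  using G_carrier by auto

lemma P_subset: "j < n \<Longrightarrow> P j \<subseteq> U"
  using bij_P by (auto dest: bij_betwE)

lemma M_proper: "i < k \<Longrightarrow> M i \<subset> U"
  using bij_M by (auto dest: bij_betwE)

lemma M_eq_iff: "i < k \<Longrightarrow> a < k \<Longrightarrow> M a = M i \<longleftrightarrow> a = i"
  using bij_M by (auto simp: bij_betw_def inj_on_def)

text \<open>Row \<open>a\<close> has a 1 exactly in the columns containing \<open>M a\<close>, so
  the sum is the parity of the interval from \<open>M a\<close> to \<open>B\<close>. Taking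
  \<open>B = M i\<close> produces unit vectors, and \<open>B = U\<close>, which is no
  \<open>M a\<close>, produces the dependency of all columns.\<close>

lemma sum_column_entries:
  assumes a: "a < k" and B: "B \<subseteq> U"
  shows "(\<Sum>j | j < n \<and> P j \<subseteq> B. G $$ (a, j)) = of_bool (M a = B)"
proof -
  have "(\<Sum>j | j < n \<and> P j \<subseteq> B. G $$ (a, j)) = (\<Sum>j<n. of_bool (M a \<subseteq> P j \<and> P j \<subseteq> B))"
    using a by (intro sum.mono_neutral_cong_left) (auto simp: G_entry)
  also have "\<dots> = (\<Sum>X\<in>Pow U. of_bool (M a \<subseteq> X \<and> X \<subseteq> B))"
    by (rule sum.reindex_bij_betw[OF bij_P])
  also have "\<dots> = (\<Sum>X | M a \<subseteq> X \<and> X \<subseteq> B. 1)"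
    using finite_U B by (intro sum.mono_neutral_cong_right) auto
  also have "\<dots> = of_bool (M a = B)"
    using finite_U B by (intro sum_interval_bit) (rule finite_subset)
  finally show ?thesis .
qed

text \<open>The first of the two recovery sets of symbol \<open>i\<close>; the other is its
  complement in \<open>{..<n}\<close>.\<close>

definition down :: "nat \<Rightarrow> nat set" where
  "down i = {j. j < n \<and> P j \<subseteq> M i}"

lemma down_subset: "down i \<subseteq> {..<n}" and finite_down: "finite (down i)"
  by (auto simp: down_def)

lemma sum_down: "i < k \<Longrightarrow> a < k \<Longrightarrow> (\<Sum>j\<in>down i. G $$ (a, j)) = of_bool (a = i)"
  using sum_column_entries[of a "M i"] M_proper[of i] M_eq_iff[of i a] by (simp add: down_def)

lemma sum_row_eq_0: "a < k \<Longrightarrow> (\<Sum>j<n. G $$ (a, j)) = 0"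
proof -
  assume a: "a < k"
  have "{j. j < n \<and> P j \<subseteq> U} = {..<n}" using P_subset by auto
  then show "(\<Sum>j<n. G $$ (a, j)) = 0"
    using sum_column_entries[OF a, of U] M_proper[OF a] by auto
qed

text \<open>All columns sum to 0, so those outside \<open>down i\<close> sum to the negative of
  those inside, and over \<open>bit\<close> negation is the identity.\<close>

lemma sum_compl_down:
  assumes "i < k" "a < k"
  shows "(\<Sum>j\<in>{..<n} - down i. G $$ (a, j)) = of_bool (a = i)"
proof -
  have "(\<Sum>j\<in>{..<n} - down i. G $$ (a, j)) + (\<Sum>j\<in>down i. G $$ (a, j)) = 0"
    using sum.subset_diff[OF down_subset[of i], of "\<lambda>j. G $$ (a, j)"] sum_row_eq_0[OF assms(2)]
    by (simp only: finite_lessThan)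
  then have "(\<Sum>j\<in>{..<n} - down i. G $$ (a, j)) + of_bool (a = i) = 0"
    by (simp only: sum_down[OF assms])
  then show ?thesis by (metis add_eq_0_iff uminus_bit_def id_apply)
qed

text \<open>
  The kernel of \<open>G\<close> consists of the two constant vectors: the vanishing sums
  \<open>\<Sum>{x j. A \<subseteq> P j}\<close> with \<open>A \<noteq> U\<close> determine \<open>x\<close> by Moebius inversion.
\<close>

lemma kernel_constant:
  fixes x :: "nat \<Rightarrow> bit"
  assumes x: "\<forall>a<k. (\<Sum>j<n. x j * G $$ (a, j)) = 0" and l: "l < n" and u: "u < n" "P u = U"
  shows "x l = x u"
proof -
  \<comment> \<open>\<open>f\<close> sums \<open>x\<close> over the columns containing
    \<open>A\<close>. The row equations make it vanish on proper subsets, and \<open>f U\<close> has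
    the single term \<open>x u\<close>.\<close>
  define f where "f A = (\<Sum>j<n. x j * of_bool (A \<subseteq> P j))" for A
  have f0: "f A = 0" if A: "A \<subset> U" for A
  proof -
    obtain a where a: "a < k" "A = M a"
      using A bij_M by (metis (no_types, lifting) Diff_iff PowI bij_betw_iff_bijections lessThan_iff
          psubset_eq singletonD)
    then have "f A = (\<Sum>j<n. x j * G $$ (a, j))"
      unfolding f_def by (intro sum.cong) (auto simp: G_entry)
    then show ?thesis using x a by simp
  qed
  have fU: "f U = x u"
  proof -
    have "U \<subseteq> P j \<longleftrightarrow> j = u" if "j < n" for j
      using that P_subset[of j] u bij_P by (auto simp: bij_betw_def inj_on_def)
    then have "f U = (\<Sum>j<n. if j = u then x u else 0)"
      unfolding f_def by (intro sum.cong) auto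
    then show ?thesis using u by simp
  qed
  have "x l = (\<Sum>j<n. if j = l then x l else 0)"
    using l by simp
  also have "\<dots> = (\<Sum>j<n. x j * of_bool (P l = P j))"
    using l bij_P by (intro sum.cong) (auto simp: bij_betw_def inj_on_def)
  also have "\<dots> = (\<Sum>j<n. x j * (\<Sum>A | P l \<subseteq> A \<and> A \<subseteq> P j. 1))"
    using finite_subset[OF P_subset finite_U]
    by (intro sum.cong arg_cong2[where f = "(*)"] sum_interval_bit[symmetric]) auto
  \<comment> \<open>Moving the bound \<open>P j\<close> into the summand leaves a range for
    \<open>A\<close> that is the same for all \<open>j\<close>, so the sums can be swapped.\<close>
  also have "\<dots> = (\<Sum>j<n. x j * (\<Sum>A | P l \<subseteq> A \<and> A \<subseteq> U. of_bool (A \<subseteq> P j)))"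
    using finite_U P_subset
    by (intro sum.cong arg_cong2[where f = "(*)"] sum.mono_neutral_cong_left)
      (auto intro: finite_subset[of _ "Pow U"])
  also have "\<dots> = (\<Sum>A | P l \<subseteq> A \<and> A \<subseteq> U. f A)"
    unfolding f_def sum_distrib_left by (rule sum.swap)
  also have "\<dots> = (\<Sum>A\<in>{U}. f A)"
    using finite_U P_subset[OF l] f0
    by (intro sum.mono_neutral_right) (auto intro: finite_subset[of _ "Pow U"])
  finally show ?thesis by (simp add: fU)
qed

section \<open>The two recovery sets of a symbol\<close>

text \<open>This is the all-zero point. It and the all-one point of \<open>top_point\<close> are the
  two bottleneck servers; they also witness that neither \<open>down i\<close> nor its complement
  contains the other.\<close>

lemma zero_point: "\<exists>z<n. \<forall>i. z \<in> down i"
proof -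
  have "{} \<in> P ` {..<n}" using bij_P by (simp add: bij_betw_def)
  then obtain z where z: "z < n" "P z = {}" by auto
  then have "\<forall>i. z \<in> down i" by (simp add: down_def)
  with z show ?thesis by blast
qed

lemma top_point: "\<exists>u<n. P u = U \<and> (\<forall>i<k. u \<notin> down i)"
proof -
  have "U \<in> P ` {..<n}" using bij_P by (simp add: bij_betw_def)
  then obtain u where u: "u < n" "P u = U" by auto
  have "u \<notin> down i" if "i < k" for i
    using M_proper[OF that] u by (auto simp: down_def)
  with u show ?thesis by blast
qed

text \<open>A recovering coefficient vector and the indicator of \<open>down i\<close> have the same
  image under \<open>G\<close>, so they differ by one of the two constant vectors of the kernel. The
  support of a recovering vector is therefore \<open>down i\<close> or its complement, and
  \<open>R\<close> only has to contain it.\<close>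

lemma recovers_iff_down:
  assumes i: "i < k" and R: "R \<subseteq> {..<n}"
  shows "recovers G i R \<longleftrightarrow> down i \<subseteq> R \<or> {..<n} - down i \<subseteq> R"
proof
  assume "recovers G i R"
  then obtain c where c: "\<forall>a<k. (\<Sum>j\<in>R. c j * G $$ (a, j)) = of_bool (a = i)"
    unfolding recovers_iff[OF i[folded dim_G(1)]] dim_G by (elim conjE exE) (rule that)
  obtain u where u: "u < n" "P u = U"
    using top_point by blast
  \<comment> \<open>The coefficients extended by 0 outside \<open>R\<close>, plus the indicator of
    \<open>down i\<close>. Over \<open>bit\<close> this sum is also the difference, and the two
    copies of the unit vector cancel.\<close>
  define x where "x j = (if j \<in> R then c j else 0) + of_bool (j \<in> down i)" for j
  have "(\<Sum>j<n. x j * G $$ (a, j)) = 0" if a: "a < k" for a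
  proof -
    have "(\<Sum>j<n. (if j \<in> R then c j else 0) * G $$ (a, j)) = (\<Sum>j\<in>R. c j * G $$ (a, j))"
      using R by (intro sum.mono_neutral_cong_right) auto
    moreover have "(\<Sum>j<n. of_bool (j \<in> down i) * G $$ (a, j)) = (\<Sum>j\<in>down i. G $$ (a, j))"
      using down_subset by (intro sum.mono_neutral_cong_right) auto
    ultimately have "(\<Sum>j<n. x j * G $$ (a, j)) = of_bool (a = i) + of_bool (a = i)"
      using c a sum_down[OF i a] by (simp only: x_def distrib_right sum.distrib)
    then show ?thesis by (cases "a = i") simp_all
  qed
  then have const: "x l = x u" if "l < n" for l
    using kernel_constant[of x l u] that u by blast
  show "down i \<subseteq> R \<or> {..<n} - down i \<subseteq> R"
  proof (cases "x u = 0")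
    case True
    \<comment> \<open>Inside \<open>down i\<close> a zero of \<open>x\<close> needs the extended
      coefficient to be 1, which is possible only for \<open>l \<in> R\<close>.\<close>
    then have "x l = 0" if "l \<in> down i" for l
      using const that down_subset by auto
    then have "down i \<subseteq> R" by (fastforce simp: x_def split: if_splits)
    then show ?thesis ..
  next
    case False
    \<comment> \<open>Outside \<open>down i\<close> the indicator contributes 0, so a nonzero
      \<open>x l\<close> must come from a coefficient with \<open>l \<in> R\<close>.\<close>
    then have "x l \<noteq> 0" if "l < n" for l
      using const that by metis
    then have "{..<n} - down i \<subseteq> R" by (fastforce simp: x_def split: if_splits)
    then show ?thesis ..
  qed
next
  have suff: "recovers G i R"
    if D: "D \<subseteq> R" "\<And>a. a < k \<Longrightarrow> (\<Sum>j\<in>D. G $$ (a, j)) = of_bool (a = i)" for D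
  proof -
    have coeffs: "(\<Sum>j\<in>R. of_bool (j \<in> D) * G $$ (a, j)) = of_bool (a = i)" if "a < k" for a
    proof -
      have "(\<Sum>j\<in>R. of_bool (j \<in> D) * G $$ (a, j)) = (\<Sum>j\<in>D. G $$ (a, j))"
        using D(1) finite_subset[OF R] by (intro sum.mono_neutral_cong_right) auto
      with D(2)[OF that] show ?thesis by simp
    qed
    have "\<exists>c. \<forall>a<k. (\<Sum>j\<in>R. c j * G $$ (a, j)) = of_bool (a = i)"
      by (intro exI[of _ "\<lambda>j. of_bool (j \<in> D)"] allI impI) (rule coeffs)
    then show ?thesis using i R by (simp only: recovers_iff dim_G simp_thms)
  qed
  assume "down i \<subseteq> R \<or> {..<n} - down i \<subseteq> R"
  then show "recovers G i R"
    using suff[of "down i"] suff[of "{..<n} - down i"] sum_down sum_compl_down i by blast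
qed

lemma recovery_sets_eq:
  assumes i: "i < k"
  shows "recovery_sets G i = {down i, {..<n} - down i}"
proof -
  obtain z where z: "z < n" "\<And>i. z \<in> down i" using zero_point by blast
  obtain u where u: "u < n" "P u = U" "\<And>i. i < k \<Longrightarrow> u \<notin> down i" using top_point by blast
  have rec: "recovers G i R \<longleftrightarrow> R \<subseteq> {..<n} \<and> (down i \<subseteq> R \<or> {..<n} - down i \<subseteq> R)" for R
    using recovers_iff_down[OF i] by (auto simp: recovers_def)
  show ?thesis
    unfolding recovery_sets_def rec using z(1) z(2)[of i] u(1) u(3)[OF i] down_subset[of i] by auto
qed

section \<open>Total rate and the bottleneck servers\<close>

theorem service_rate_region_eq:
  "service_rate_region G =
    {rates \<in> nonneg_orthant k. (\<Sum>i<k. Poly_Mapping.lookup rates i) \<le> 2}"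
proof (intro Set.set_eqI iffI)
  obtain z where z: "z < n" "\<And>i. z \<in> down i" using zero_point by blast
  obtain u where u: "u < n" "P u = U" "\<And>i. i < k \<Longrightarrow> u \<notin> down i" using top_point by blast
  \<comment> \<open>Keeps the two recovery sets distinct, so that a sum over them really has two
    terms.\<close>
  have neq: "down i \<noteq> {..<n} - down i" for i
    using z by auto
  fix rates
  {
    assume "rates \<in> service_rate_region G"
    then obtain \<mu> where orth: "rates \<in> nonneg_orthant k"
      and dem: "\<forall>i<k. (\<Sum>R\<in>recovery_sets G i. \<mu> i R) = Poly_Mapping.lookup rates i"
      and cap: "\<forall>l<n. (\<Sum>i<k. \<Sum>R | R \<in> recovery_sets G i \<and> l \<in> R. \<mu> i R) \<le> 1"
      by (auto simp: service_rate_region_def)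
    \<comment> \<open>For each symbol, \<open>z\<close> lies only in the first recovery set and
      \<open>u\<close> only in the second, so their loads add up to the whole rate. The bound 2 is
      the joint capacity of these two servers.\<close>
    have "(\<Sum>R | R \<in> recovery_sets G i \<and> z \<in> R. \<mu> i R) +
        (\<Sum>R | R \<in> recovery_sets G i \<and> u \<in> R. \<mu> i R) = Poly_Mapping.lookup rates i"
      if "i < k" for i
    proof -
      have "{R. R \<in> recovery_sets G i \<and> z \<in> R} = {down i}"
        "{R. R \<in> recovery_sets G i \<and> u \<in> R} = {{..<n} - down i}"
        using z u that by (auto simp: recovery_sets_eq)
      with dem that neq show ?thesis by (simp add: recovery_sets_eq)
    qed
    then have "(\<Sum>i<k. Poly_Mapping.lookup rates i) =
        (\<Sum>i<k. \<Sum>R | R \<in> recovery_sets G i \<and> z \<in> R. \<mu> i R) +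
        (\<Sum>i<k. \<Sum>R | R \<in> recovery_sets G i \<and> u \<in> R. \<mu> i R)"
      by (simp flip: sum.distrib)
    also have "\<dots> \<le> 1 + 1"
      using cap z u by (intro add_mono) auto
    finally show "rates \<in> {rates \<in> nonneg_orthant k. (\<Sum>i<k. Poly_Mapping.lookup rates i) \<le> 2}"
      using orth by simp
  next
    assume rates: "rates \<in> {rates \<in> nonneg_orthant k. (\<Sum>i<k. Poly_Mapping.lookup rates i) \<le> 2}"
    \<comment> \<open>The value can be the same for all \<open>R\<close>, since only the two
      recovery sets of \<open>i\<close> are ever summed over.\<close>
    define \<mu> :: "nat \<Rightarrow> nat set \<Rightarrow> real" where "\<mu> i R = Poly_Mapping.lookup rates i / 2" for i R
    have half: "(\<Sum>R | R \<in> recovery_sets G i \<and> l \<in> R. \<mu> i R) = Poly_Mapping.lookup rates i / 2"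
      if "i < k" "l < n" for i l
    proof -
      \<comment> \<open>Every server lies in exactly one of two complementary sets, hence carries
        half of each rate.\<close>
      have "{R. R \<in> recovery_sets G i \<and> l \<in> R} = {if l \<in> down i then down i else {..<n} - down i}"
        using that by (auto simp: recovery_sets_eq)
      then show ?thesis by (simp add: \<mu>_def)
    qed
    have "(\<Sum>i<k. \<Sum>R | R \<in> recovery_sets G i \<and> l \<in> R. \<mu> i R) \<le> 1" if "l < n" for l
    proof -
      have "(\<Sum>i<k. \<Sum>R | R \<in> recovery_sets G i \<and> l \<in> R. \<mu> i R) =
          (\<Sum>i<k. Poly_Mapping.lookup rates i / 2)"
        by (rule sum.cong[OF refl], rule half) (simp_all add: that)
      also have "\<dots> = (\<Sum>i<k. Poly_Mapping.lookup rates i) / 2"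
        by (rule sum_divide_distrib[symmetric])
      finally show ?thesis using rates by simp
    qed
    moreover have "(\<Sum>R\<in>recovery_sets G i. \<mu> i R) = Poly_Mapping.lookup rates i" if "i < k" for i
      using that neq by (simp add: recovery_sets_eq \<mu>_def)
    moreover have "0 \<le> \<mu> i R" if "i < k" for i R
      using rates that by (simp add: \<mu>_def mem_nonneg_orthant_iff)
    ultimately show "rates \<in> service_rate_region G"
      using rates by (auto simp: service_rate_region_def intro!: exI[of _ \<mu>])
  }
qed

section \<open>Linear independence of the rows\<close>

text \<open>By \<open>sum_down\<close>, adding the entries of a row over the columns in
  \<open>down i\<close> gives 1 for row \<open>i\<close> and 0 for every other row. These
  functionals are dual to the rows and make them independent.\<close>

lemma code_dim_row_span:
  "code_dim n (LinearCombinations.module.span class_ring (module_vec TYPE(bit) n) (row G ` {..<k})) = k"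
proof -
  interpret vec_space "TYPE(bit)" n .
  \<comment> \<open>The rank is defined through columns, so the rows of \<open>G\<close> enter as
    columns of its transpose.\<close>
  let ?A = "transpose_mat G"
  have A: "?A \<in> carrier_mat n k" using G_carrier by simp
  have cols: "set (cols ?A) = row G ` {..<k}"
    by (auto simp: rows_def)
  \<comment> \<open>Distinctness lets a dependency of the set of columns be read as a kernel vector
    of \<open>?A\<close>.\<close>
  have dist: "distinct (cols ?A)"
    unfolding distinct_conv_nth
  proof (intro allI impI)
    fix a b assume ab: "a < length (cols ?A)" "b < length (cols ?A)" "a \<noteq> b"
    show "cols ?A ! a \<noteq> cols ?A ! b"
    proof
      assume "cols ?A ! a = cols ?A ! b"
      then have "row G a = row G b" using ab by simp
      then have "G $$ (a, j) = G $$ (b, j)" if "j < n" for j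
        using that ab by (metis A G_carrier carrier_matD cols_length index_row(1))
      then have "(\<Sum>j\<in>down a. G $$ (a, j)) = (\<Sum>j\<in>down a. G $$ (b, j))"
        using down_subset by (intro sum.cong) auto
      then show False using ab by (simp add: sum_down)
    qed
  qed
  have "\<not> lin_dep (set (cols ?A))"
  proof
    assume "lin_dep (set (cols ?A))"
    then obtain v where v: "v \<in> carrier_vec k" "v \<noteq> 0\<^sub>v k" "?A *\<^sub>v v = 0\<^sub>v n"
      using lin_depE[OF A] dist by metis
    have Av: "(\<Sum>a<k. G $$ (a, j) * v $ a) = 0" if "j < n" for j
    proof -
      have "(?A *\<^sub>v v) $ j = (\<Sum>a<k. G $$ (a, j) * v $ a)"
        using v(1) that by (simp add: scalar_prod_def atLeast0LessThan)
      then show ?thesis using v(3) that by (simp only: index_zero_vec)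
    qed
    have "v $ i = 0" if i: "i < k" for i
    proof -
      \<comment> \<open>Adding the equations \<open>Av\<close> over the columns in
        \<open>down i\<close> isolates \<open>v $ i\<close>.\<close>
      have "0 = (\<Sum>j\<in>down i. \<Sum>a<k. G $$ (a, j) * v $ a)"
        by (intro sum.neutral[symmetric] ballI Av) (use down_subset in auto)
      also have "\<dots> = (\<Sum>a<k. (\<Sum>j\<in>down i. G $$ (a, j)) * v $ a)"
        unfolding sum_distrib_right by (rule sum.swap)
      also have "\<dots> = (\<Sum>a<k. if a = i then v $ i else 0)"
        using i by (intro sum.cong) (auto simp: sum_down)
      finally show ?thesis using i by simp
    qed
    with v show False by (metis carrier_vecD eq_vecI index_zero_vec)
  qed
  then have "rank ?A = k"
    using lin_indpt_full_rank[OF A dist] by blast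
  then show ?thesis
    unfolding rank_def cols code_dim_def .
qed

end

section \<open>The Reed-Muller code as the row space of its matrix\<close>

lemma dim_rm_generator_matrix: "rm_generator_matrix r (Suc r) \<in> carrier_mat (2 ^ Suc r - 1) (2 ^ Suc r)"
  unfolding rm_generator_matrix_def sum_choose_Suc_upto by simp

interpretation rm: proper_subset_incidence "{1..Suc r}" "2 ^ Suc r" "2 ^ Suc r - 1" "rm_support (Suc r)"
  "\<lambda>i. set (rm_monomials r (Suc r) ! i)" "rm_generator_matrix r (Suc r)" for r
proof
  fix i j :: nat
  assume ij: "i < 2 ^ Suc r - 1" "j < 2 ^ Suc r"
  then have "set (rm_monomials r (Suc r) ! i) \<subseteq> {1..Suc r}"
    using bij_betwE[OF bij_rm_monomials] by blast
  then show "rm_generator_matrix r (Suc r) $$ (i, j) =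
      of_bool (set (rm_monomials r (Suc r) ! i) \<subseteq> rm_support (Suc r) j)"
    using ij by (simp only: rm_generator_matrix_def sum_choose_Suc_upto index_mat prod.case
        rm_monomial_at_point)
qed (rule finite_atLeastAtMost bij_rm_support bij_rm_monomials dim_rm_generator_matrix)+

text \<open>Over \<open>bit\<close> every positive power of \<open>x\<close> is \<open>x\<close>, so
  the values of a monomial depend only on its set of variables.\<close>

lemma mpoly_eval_rm_point:
  assumes "p \<in> mpolys_upto r m"
  shows "mpoly_eval p (rm_point m j) =
    (\<Sum>a\<in>Poly_Mapping.keys p. Poly_Mapping.lookup p a * of_bool (Poly_Mapping.keys a \<subseteq> rm_support m j))"
  unfolding mpoly_eval_def
proof (intro sum.cong refl arg_cong2[where f = "(*)"])
  fix a assume "a \<in> Poly_Mapping.keys p"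
  then have "Poly_Mapping.keys a \<subseteq> {1..m}" using assms by (auto simp: mpolys_upto_def)
  moreover have "x ^ Poly_Mapping.lookup a t = x" if "t \<in> Poly_Mapping.keys a" for x :: bit and t
    using that by (cases x) (auto simp: in_keys_iff)
  ultimately show "(\<Prod>t\<in>Poly_Mapping.keys a. rm_point m j t ^ Poly_Mapping.lookup a t) =
      of_bool (Poly_Mapping.keys a \<subseteq> rm_support m j)"
    by (simp flip: rm_monomial_at_point)
qed

text \<open>Every exponent on the support is at least 1. Hence a monomial of degree at most
  \<open>r\<close> involves at most \<open>r\<close> variables.\<close>

lemma card_keys_le_sum_lookup:
  fixes a :: "'a \<Rightarrow>\<^sub>0 nat"
  shows "card (Poly_Mapping.keys a) \<le> (\<Sum>t\<in>Poly_Mapping.keys a. Poly_Mapping.lookup a t)"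
  using sum_mono[of "Poly_Mapping.keys a" "\<lambda>_. 1" "Poly_Mapping.lookup a"]
  by (auto simp: in_keys_iff Suc_le_eq)

text \<open>A polynomial agrees on binary points with its squarefree reduction, and the squarefree
  monomials of degree at most \<open>r\<close> give the rows of the matrix. This reduces the
  dimension of the code to the independence of the rows.\<close>

lemma reed_muller_code_eq_row_span:
  "reed_muller_code r (Suc r) =
    LinearCombinations.module.span class_ring (module_vec TYPE(bit) (2 ^ Suc r))
      (row (rm_generator_matrix r (Suc r)) ` {..<2 ^ Suc r - 1})"
proof -
  define m n k G where "m = Suc r" "n = (2::nat) ^ m" "k = n - 1" "G = rm_generator_matrix r m"
  define M where "M = (\<lambda>i. set (rm_monomials r m ! i))"
  note defs = \<open>m = Suc r\<close> \<open>n = 2 ^ m\<close> \<open>k = n - 1\<close> \<open>G = rm_generator_matrix r m\<close> M_def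
  have G: "G \<in> carrier_mat k n"
    unfolding defs by (rule dim_rm_generator_matrix)
  have entry: "G $$ (i, j) = of_bool (M i \<subseteq> rm_support m j)" if "i < k" "j < n" for i j
    using that unfolding defs by (rule rm.G_entry)
  have bij: "bij_betw M {..<k} (Pow {1..m} - {{1..m}})"
    using bij_rm_monomials[of r] by (simp only: defs)
  interpret vec_space "TYPE(bit)" n .
  have span: "w \<in> span (row G ` {..<k}) \<longleftrightarrow>
      w \<in> carrier_vec n \<and> (\<exists>c. \<forall>j<n. w $ j = (\<Sum>i<k. c i * of_bool (M i \<subseteq> rm_support m j)))" for w
  proof -
    have "(\<Sum>i<k. c i * row G i $ j) = (\<Sum>i<k. c i * of_bool (M i \<subseteq> rm_support m j))"
      if "j < n" for c j
      using that G by (intro sum.cong) (auto simp: entry)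
    then show ?thesis
      using G by (subst span_image_iff) auto
  qed
  have "reed_muller_code r m = span (row G ` {..<k})"
  proof (intro Set.set_eqI iffI)
    fix w assume "w \<in> reed_muller_code r m"
    then obtain p where p: "p \<in> mpolys_upto r m"
      and w: "w = Matrix.vec n (\<lambda>j. mpoly_eval p (rm_point m j))"
      by (auto simp: reed_muller_code_def defs)
    \<comment> \<open>Monomials with the same variables merge when exponents are reduced, so their
      coefficients are added.\<close>
    define c where "c i = (\<Sum>a | a \<in> Poly_Mapping.keys p \<and> Poly_Mapping.keys a = M i. Poly_Mapping.lookup p a)" for i
    have keys: "Poly_Mapping.keys ` Poly_Mapping.keys p \<subseteq> Pow {1..m} - {{1..m}}"
    proof
      fix A assume "A \<in> Poly_Mapping.keys ` Poly_Mapping.keys p"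
      then obtain a where a: "a \<in> Poly_Mapping.keys p" "A = Poly_Mapping.keys a" by blast
      with p have "A \<subseteq> {1..m}" "card A \<le> r"
        using card_keys_le_sum_lookup[of a] by (auto simp: mpolys_upto_def)
      moreover from this have "A \<noteq> {1..m}"
        using \<open>m = Suc r\<close> by auto
      ultimately show "A \<in> Pow {1..m} - {{1..m}}" by blast
    qed
    have wj: "w $ j = (\<Sum>i<k. c i * of_bool (M i \<subseteq> rm_support m j))" if j: "j < n" for j
    proof -
      let ?h = "\<lambda>a. Poly_Mapping.lookup p a * of_bool (Poly_Mapping.keys a \<subseteq> rm_support m j)"
      have "w $ j = sum ?h (Poly_Mapping.keys p)"
        using j by (simp add: w mpoly_eval_rm_point[OF p])
      also have "\<dots> = (\<Sum>A\<in>Pow {1..m} - {{1..m}}. \<Sum>a | a \<in> Poly_Mapping.keys p \<and> Poly_Mapping.keys a = A. ?h a)"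
        using keys by (intro sum.group[symmetric]) auto
      also have "\<dots> = (\<Sum>i<k. \<Sum>a | a \<in> Poly_Mapping.keys p \<and> Poly_Mapping.keys a = M i. ?h a)"
        by (rule sum.reindex_bij_betw[OF bij, symmetric])
      also have "\<dots> = (\<Sum>i<k. c i * of_bool (M i \<subseteq> rm_support m j))"
        unfolding c_def sum_distrib_right by (intro sum.cong) auto
      finally show ?thesis .
    qed
    show "w \<in> span (row G ` {..<k})"
      unfolding span
      by (intro conjI exI[of _ c] allI impI) (simp add: w, rule wj)
  next
    fix w assume "w \<in> span (row G ` {..<k})"
    then obtain c where w: "w \<in> carrier_vec n"
      and c: "\<forall>j<n. w $ j = (\<Sum>i<k. c i * of_bool (M i \<subseteq> rm_support m j))"
      unfolding span by (elim conjE exE) (rule that)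
    \<comment> \<open>The squarefree exponent vector with variable set \<open>M i\<close>, used to
      turn a combination of rows back into a polynomial.\<close>
    define mono :: "nat \<Rightarrow> (nat \<Rightarrow>\<^sub>0 nat)" where
      "mono i = Abs_poly_mapping (\<lambda>t. of_bool (t \<in> M i))" for i
    have lookup_mono: "Poly_Mapping.lookup (mono i) t = of_bool (t \<in> M i)" for i t
      unfolding mono_def by (subst lookup_Abs_poly_mapping) (auto simp: M_def)
    then have keys_mono: "Poly_Mapping.keys (mono i) = M i" for i
      by (auto simp: in_keys_iff)
    have inj: "inj_on mono {..<k}"
      using bij keys_mono by (metis bij_betw_imp_inj_on inj_on_def)
    define p where "p = (\<Sum>i<k. Poly_Mapping.single (mono i) (c i))"
    have lookup_p: "Poly_Mapping.lookup p a = (\<Sum>i<k. c i when mono i = a)" for a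
      by (simp add: p_def lookup_sum lookup_single)
    \<comment> \<open>Only an inclusion, since a coefficient \<open>c i\<close> may be 0.\<close>
    have keys_p: "Poly_Mapping.keys p \<subseteq> mono ` {..<k}"
    proof
      fix a assume "a \<in> Poly_Mapping.keys p"
      then have "(\<Sum>i<k. c i when mono i = a) \<noteq> 0" unfolding in_keys_iff lookup_p .
      then obtain i where i: "i \<in> {..<k}" "(c i when mono i = a) \<noteq> 0"
        by (rule sum.not_neutral_contains_not_neutral)
      then have "mono i = a" by (metis zero_when when_simps(2))
      with i show "a \<in> mono ` {..<k}" by blast
    qed
    have lookup_p_mono: "Poly_Mapping.lookup p (mono i) = c i" if "i < k" for i
    proof -
      have "Poly_Mapping.lookup p (mono i) = (\<Sum>l<k. if l = i then c i else 0)"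
        unfolding lookup_p using inj that
        by (intro sum.cong) (auto simp: when_def inj_on_def)
      then show ?thesis using that by simp
    qed
    have p: "p \<in> mpolys_upto r m"
      unfolding mpolys_upto_def
    proof (intro CollectI ballI conjI)
      fix a assume "a \<in> Poly_Mapping.keys p"
      then obtain i where i: "i < k" "a = mono i" using keys_p by auto
      have M: "M i \<subset> {1..m}" using bij_betwE[OF bij] i by auto
      then show "Poly_Mapping.keys a \<subseteq> {1..m}" by (simp add: i keys_mono)
      have "(\<Sum>t\<in>Poly_Mapping.keys a. Poly_Mapping.lookup a t) = card (M i)"
        by (simp add: i keys_mono lookup_mono)
      also have "\<dots> < card {1..m}"
        using M by (intro psubset_card_mono) auto
      finally show "(\<Sum>t\<in>Poly_Mapping.keys a. Poly_Mapping.lookup a t) \<le> r"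
        using \<open>m = Suc r\<close> by simp
    qed
    have "w $ j = mpoly_eval p (rm_point m j)" if "j < n" for j
    proof -
      have "mpoly_eval p (rm_point m j) = (\<Sum>a\<in>mono ` {..<k}.
          Poly_Mapping.lookup p a * of_bool (Poly_Mapping.keys a \<subseteq> rm_support m j))"
        unfolding mpoly_eval_rm_point[OF p] using keys_p
        by (intro sum.mono_neutral_left) (auto simp: in_keys_iff)
      also have "\<dots> = (\<Sum>i<k. c i * of_bool (M i \<subseteq> rm_support m j))"
        by (simp add: sum.reindex[OF inj] keys_mono lookup_p_mono)
      finally show ?thesis using c that by (simp only:)
    qed
    then have "w = Matrix.vec n (\<lambda>j. mpoly_eval p (rm_point m j))"
      using w by (intro eq_vecI) auto
    with p show "w \<in> reed_muller_code r m"
      by (auto simp: reed_muller_code_def defs)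
  qed
  then show ?thesis by (simp only: defs)
qed

theorem theorem1:
  fixes r k :: nat and G :: "bit mat"
  assumes "r \<ge> 2"
    and "G = rm_generator_matrix r (r + 1)"
    and "k = dim_row G"
  shows "code_dim (2 ^ (r + 1)) (reed_muller_code r (r + 1)) = k \<and>
    k = 2 ^ (r + 1) - 1 \<and>
    service_rate_region G =
      {rates \<in> nonneg_orthant k. (\<Sum>i<k. Poly_Mapping.lookup rates i) \<le> 2} \<and>
    {rates \<in> nonneg_orthant k. (\<Sum>i<k. Poly_Mapping.lookup rates i) \<le> 2} =
      convex hull ({0} \<union> {2 *\<^sub>R real_unit i | i. i < k})"
proof (intro conjI)
  have G: "G = rm_generator_matrix r (Suc r)" using assms(2) by simp
  have k: "k = 2 ^ Suc r - 1" by (simp only: assms(3) G rm.dim_G)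
  show "k = 2 ^ (r + 1) - 1" by (simp only: k Suc_eq_plus1)
  show "code_dim (2 ^ (r + 1)) (reed_muller_code r (r + 1)) = k"
    unfolding k Suc_eq_plus1[symmetric] reed_muller_code_eq_row_span by (rule rm.code_dim_row_span)
  show "service_rate_region G =
      {rates \<in> nonneg_orthant k. (\<Sum>i<k. Poly_Mapping.lookup rates i) \<le> 2}"
    unfolding k G by (rule rm.service_rate_region_eq)
  show "{rates \<in> nonneg_orthant k. (\<Sum>i<k. Poly_Mapping.lookup rates i) \<le> 2} =
      convex hull ({0} \<union> {2 *\<^sub>R real_unit i | i. i < k})"
    by (rule scaled_simplex_eq_convex_hull) simp
qed

end
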